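(* Let $m\in \mathbb{N}\cup\{\infty\}$, $m\geq 2$. Let $C$ be a convex compact subset of $\mathbb{R}^n$, and let $f:C\to\mathbb{R}$ be a convex function having a (not necessarily convex) $C^{m}$ extension to an open neighbourhood of $C$. If $f$ and its derivatives satisfy $(CW^k)$ with a strict inequality on $C$ for some integer $k$ with $2\leq k\leq m$, then there exists a convex function $F\in C^{m}(\mathbb{R}^n)$ such that $F=f$ on $C$.
   Context: The derivatives $D^jf(y)$, $y\in C$, are those of the given $C^m$ extension of $f$ to an open neighbourhood of $C$. $\mathbb{S}^{n-1}$ is the Euclidean unit sphere of $\mathbb{R}^n$. $D^{j}f(y)(w^{j-2},v^2)$ denotes the $j$-th derivative at $y$, as a symmetric $j$-linear form, evaluated with $w$ repeated $j-2$ times and $v$ repeated twice. $f$ and its derivatives satisfy $(CW^k)$ with a strict inequality on $C$ if there are $\eta>0$ and $t_0>0$ such that $$D^2f(y)(v^2)+ t\, D^3f(y)(w,v^2)+ \cdots + \frac{t^{k-2}}{(k-2)!} D^{k}f(y)(w^{k-2},v^2) \geq \eta t^{k-2}$$ for all $y\in C$, $v,w\in\mathbb{S}^{n-1}$, $0<t\le t_0$. *)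

theory Defs
  imports "HOL-Analysis.Analysis" "HOL-Library.Extended_Nat"
begin

text \<open>
  \<open>hderiv f [u1, ..., uj] y\<close> is $D^j f(y)(u_1, \dots, u_j)$. The head of the list is the direction
  of the derivative taken last; the order is immaterial where \<open>f\<close> is $C^j$.
  The value is meaningful only where the derivatives exist.
\<close>

primrec hderiv :: "('a::real_normed_vector \<Rightarrow> real) \<Rightarrow> 'a list \<Rightarrow> 'a \<Rightarrow> real" where
  "hderiv f [] = f"
| "hderiv f (u # us) = (\<lambda>y. frechet_derivative (hderiv f us) (at y) u)"

text \<open>
  \<open>U\<close> is meant to be open, \<open>m = \<infinity>\<close> is allowed. In finite dimension, $D^j f$ is differentiable
  (resp. continuous) as a map into the $j$-linear forms iff all the scalar functions
  $y \mapsto D^j f(y)(u_1, \dots, u_j)$ are.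
\<close>

definition Cm_on :: "enat \<Rightarrow> 'a::euclidean_space set \<Rightarrow> ('a \<Rightarrow> real) \<Rightarrow> bool" where
  "Cm_on m U f \<longleftrightarrow>
    (\<forall>us. enat (length us) < m \<longrightarrow> (\<forall>y\<in>U. hderiv f us differentiable (at y))) \<and>
    (\<forall>us. enat (length us) \<le> m \<longrightarrow> continuous_on U (hderiv f us))"

text \<open>
  The condition $(CW^k)$ with a strict inequality on \<open>C\<close>, for a function \<open>f\<close> that is $C^k$ near \<open>C\<close>;
  the summand for \<open>j\<close> contains $D^j f(y)(w^{j-2}, v^2)$.
\<close>

definition CW_strict ::
  "nat \<Rightarrow> 'a::euclidean_space set \<Rightarrow> ('a \<Rightarrow> real) \<Rightarrow> bool" where
  "CW_strict k C f \<longleftrightarrow>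
    (\<exists>\<eta>>0. \<exists>t0>0. \<forall>y\<in>C. \<forall>v\<in>sphere 0 1. \<forall>w\<in>sphere 0 1. \<forall>t. 0 < t \<and> t \<le> t0 \<longrightarrow>
      (\<Sum>j=2..k. t ^ (j - 2) / fact (j - 2) * hderiv f (replicate (j - 2) w @ [v, v]) y)
        \<ge> \<eta> * t ^ (k - 2))"

end

theory Submission
  imports Defs "HOL-Computational_Algebra.Polynomial"
begin

text \<open>
  The strict form of $(CW^k)$ forces the given $C^m$ extension \<open>g\<close> to be convex on a whole neighbourhood
  of \<open>C\<close>. Indeed, the left-hand side of $(CW^k)$ is the Taylor polynomial of $D^2g(y + tw)(v^2)$ in \<open>t\<close>,
  and the Taylor remainder is $o(t^{k-2})$ uniformly in \<open>y\<close>, \<open>v\<close>, \<open>w\<close>, so the term $\eta t^{k-2}$ beats it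
  and $D^2g \<ge> 0$ at all points close to \<open>C\<close>
  (\<open>CW_strict_imp_second_derivative_nonneg\<close>, \<open>second_derivative_nonneg_imp_convex_on\<close>).

  Extending a function that is convex and $C^m$ on a neighbourhood of a compact convex set is then
  a gluing problem (\<open>convex_extension_from_neighbourhood\<close>). Take a smooth convex function \<open>H\<close> on the
  whole space that is below \<open>g\<close> on \<open>C\<close> and above \<open>g\<close> on a shell around \<open>C\<close>; it is a multiple of a
  finite sum of smooth ramps of affine functions, minus a constant
  (\<open>smooth_convex_function_vanishing_on\<close>). The maximum of \<open>g\<close> and \<open>H\<close> is convex, equals \<open>g\<close> on \<open>C\<close> and
  \<open>H\<close> on the shell, and so extends by \<open>H\<close>. To keep it $C^m$, the maximum is replaced by
  $H + \varphi(g - H)$, where $\varphi$ is a smooth convex ramp (\<open>smooth_ramp\<close>, \<open>convex_on_smooth_max\<close>); on \<open>C\<close>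
  this changes the value by an additive constant only, which is corrected at the end. That the
  glued function is convex everywhere follows from a local midpoint inequality
  (\<open>locally_midpoint_convex_imp_convex\<close>).
\<close>

section \<open>Locality of iterated derivatives\<close>

text \<open>
  \<^const>\<open>frechet_derivative\<close> is a choice among the derivatives, so it is local also at points where no
  derivative exists: equal germs have equal sets of derivatives to choose from.
\<close>

lemma frechet_derivative_cong_open:
  assumes "open U" "x \<in> U" "\<And>y. y \<in> U \<Longrightarrow> f y = g y"
  shows "frechet_derivative f (at x) = frechet_derivative g (at x)"
proof -
  have "(f has_derivative f') (at x) \<longleftrightarrow> (g has_derivative f') (at x)" for f'
    using assms has_derivative_transform_within_open[of _ f' x UNIV U]
    by (metis (no_types, lifting))
  then show ?thesis
    unfolding frechet_derivative_def by simp
qed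

lemma differentiable_cong_open:
  assumes "open U" "x \<in> U" "\<And>y. y \<in> U \<Longrightarrow> f y = g y"
  shows "f differentiable at x \<longleftrightarrow> g differentiable at x"
  unfolding differentiable_def
  using assms has_derivative_transform_within_open[of _ _ x UNIV U]
  by (metis (no_types, lifting))

lemma hderiv_cong:
  assumes "open U" "\<And>y. y \<in> U \<Longrightarrow> f y = g y" "x \<in> U"
  shows "hderiv f us x = hderiv g us x"
  using assms(3)
proof (induction us arbitrary: x)
  case (Cons u us)
  then show ?case
    using frechet_derivative_cong_open[OF assms(1), of x "hderiv f us" "hderiv g us"] by simp
qed (simp add: assms)

lemma hderiv_append: "hderiv f (us @ vs) = hderiv (hderiv f vs) us"
  by (induction us) auto

lemma Cm_on_cong:
  assumes "open U" "\<And>y. y \<in> U \<Longrightarrow> f y = g y" "Cm_on m U f"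
  shows "Cm_on m U g"
proof -
  have "hderiv f us y = hderiv g us y" if "y \<in> U" for us y
    using hderiv_cong[of U f g] assms that by blast
  then show ?thesis
    using assms(3) differentiable_cong_open[OF assms(1)] continuous_on_cong[of U U]
    unfolding Cm_on_def by (metis (no_types, lifting))
qed

lemma Cm_on_subset: "Cm_on m U f \<Longrightarrow> V \<subseteq> U \<Longrightarrow> Cm_on m V f"
  unfolding Cm_on_def by (meson continuous_on_subset subsetD)

lemma Cm_on_Un:
  assumes "open U" "open V" "Cm_on m U f" "Cm_on m V f"
  shows "Cm_on m (U \<union> V) f"
  using assms unfolding Cm_on_def by (auto intro: continuous_on_open_Un)

text \<open>
  The order $m = \infty$ is treated by reduction to all finite orders, which are accessible to induction.
\<close>

lemma Cm_on_iff_finite: "Cm_on m U f \<longleftrightarrow> (\<forall>n. enat n \<le> m \<longrightarrow> Cm_on (enat n) U f)"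
proof
  assume "Cm_on m U f"
  then show "\<forall>n. enat n \<le> m \<longrightarrow> Cm_on (enat n) U f"
    unfolding Cm_on_def by (meson order_less_le_trans order_trans)
next
  assume *: "\<forall>n. enat n \<le> m \<longrightarrow> Cm_on (enat n) U f"
  have "\<forall>y\<in>U. hderiv f us differentiable (at y)" if "enat (length us) < m" for us
  proof -
    have "enat (Suc (length us)) \<le> m"
      using that by (simp add: Suc_ile_eq)
    then show ?thesis
      using * unfolding Cm_on_def by auto
  qed
  then show "Cm_on m U f"
    using * unfolding Cm_on_def by auto
qed

section \<open>Closure properties of $C^m$ functions\<close>

lemma Cm_on_0: "Cm_on 0 U f \<longleftrightarrow> continuous_on U f"
  by (simp add: Cm_on_def zero_enat_def)

text \<open>
  Introduction and destruction of $C^{n+1}$ in terms of the first derivative being $C^n$. The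
  derivative that is peeled off is the one taken \<^emph>\<open>first\<close>, at the end of the list of directions,
  so that the remaining iterated derivatives are those of the function \<open>hderiv f [u]\<close>. The
  closure properties below rest on inductions on \<open>n\<close> along these two rules.
\<close>

lemma Cm_on_SucI:
  assumes "open U" and der: "\<And>x. x \<in> U \<Longrightarrow> (f has_derivative f' x) (at x)"
    and f': "\<And>u. Cm_on (enat n) U (\<lambda>x. f' x u)"
  shows "Cm_on (enat (Suc n)) U f"
proof -
  have h1: "frechet_derivative f (at x) = f' x" if "x \<in> U" for x
    using der[OF that] frechet_derivative_at by metis
  have D: "Cm_on (enat n) U (hderiv f [u])" for u
    by (rule Cm_on_cong[OF \<open>open U\<close> _ f'[of u]]) (simp add: h1)
  have dif: "f differentiable at x" if "x \<in> U" for x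
    using der[OF that] by (auto simp: differentiable_def)
  have con: "continuous_on U f"
    by (simp add: continuous_at_imp_continuous_on dif differentiable_imp_continuous_within)
  show ?thesis
    unfolding Cm_on_def
  proof (intro conjI allI impI)
    fix us :: "'a list"
    assume "enat (length us) < enat (Suc n)"
    then show "\<forall>y\<in>U. hderiv f us differentiable at y"
      using D dif unfolding Cm_on_def
      by (cases us rule: rev_cases) (auto simp: hderiv_append simp del: hderiv.simps(2))
  next
    fix us :: "'a list"
    assume "enat (length us) \<le> enat (Suc n)"
    then show "continuous_on U (hderiv f us)"
      using D con unfolding Cm_on_def
      by (cases us rule: rev_cases) (auto simp: hderiv_append simp del: hderiv.simps(2))
  qed
qed

lemma hderiv_has_derivative:
  assumes "Cm_on m U f" "enat (length us) < m" "x \<in> U"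
  shows "(hderiv f us has_derivative (\<lambda>u. hderiv f (u # us) x)) (at x)"
  using assms frechet_derivative_works unfolding Cm_on_def by auto

lemma Cm_on_SucD:
  assumes "Cm_on (enat (Suc n)) U f"
  shows "x \<in> U \<Longrightarrow> (f has_derivative (\<lambda>u. hderiv f [u] x)) (at x)"
    and "Cm_on (enat n) U (hderiv f [u])"
proof -
  show "x \<in> U \<Longrightarrow> (f has_derivative (\<lambda>u. hderiv f [u] x)) (at x)"
    using hderiv_has_derivative[OF assms, of "[]" x] by (simp add: zero_enat_def)
  have "hderiv (hderiv f [u]) us = hderiv f (us @ [u])" for us
    by (simp add: hderiv_append)
  then show "Cm_on (enat n) U (hderiv f [u])"
    using assms unfolding Cm_on_def by (auto simp del: hderiv.simps(2))
qed

lemma Cm_on_le: "Cm_on m U f \<Longrightarrow> l \<le> m \<Longrightarrow> Cm_on l U f"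
  unfolding Cm_on_def by (meson order_less_le_trans order_trans)

lemma Cm_on_const:
  assumes "open U" shows "Cm_on m U (\<lambda>x. c)"
proof -
  have "Cm_on (enat n) U (\<lambda>x. c)" for n c
    by (induction n arbitrary: c)
      (auto simp: Cm_on_0 simp flip: zero_enat_def intro!: Cm_on_SucI[OF assms has_derivative_const])
  then show ?thesis
    using Cm_on_iff_finite by blast
qed

lemma Cm_on_bounded_linear:
  assumes "open U" "bounded_linear f" shows "Cm_on m U f"
proof -
  have "Cm_on (enat n) U f" for n
    using assms
    by (cases n)
      (auto simp: Cm_on_0 linear_continuous_on simp flip: zero_enat_def
        intro!: Cm_on_SucI[OF _ bounded_linear_imp_has_derivative] Cm_on_const)
  then show ?thesis
    using Cm_on_iff_finite by blast
qed

lemma Cm_on_add: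
  assumes "open U" "Cm_on m U f" "Cm_on m U g"
  shows "Cm_on m U (\<lambda>x. f x + g x)"
proof -
  have "Cm_on (enat n) U (\<lambda>x. f x + g x)"
    if "Cm_on (enat n) U f" "Cm_on (enat n) U g" for n f g
    using that
  proof (induction n arbitrary: f g)
    case 0
    then show ?case
      by (simp add: Cm_on_0 continuous_on_add flip: zero_enat_def)
  next
    case (Suc n)
    show ?case
      by (rule Cm_on_SucI[OF \<open>open U\<close> has_derivative_add[OF Cm_on_SucD(1) Cm_on_SucD(1)]])
        (use Suc.prems in \<open>auto simp del: hderiv.simps intro!: Suc.IH Cm_on_SucD(2)\<close>)
  qed
  then show ?thesis
    using assms(2,3) Cm_on_iff_finite[of m] by blast
qed

lemma Cm_on_mult:
  assumes "open U" "Cm_on m U f" "Cm_on m U g"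
  shows "Cm_on m U (\<lambda>x. f x * g x)"
proof -
  have "Cm_on (enat n) U (\<lambda>x. f x * g x)"
    if "Cm_on (enat n) U f" "Cm_on (enat n) U g" for n f g
    using that
  proof (induction n arbitrary: f g)
    case 0
    then show ?case
      by (simp add: Cm_on_0 continuous_on_mult flip: zero_enat_def)
  next
    case (Suc n)
    have "Cm_on (enat n) U f" "Cm_on (enat n) U g"
      using Suc.prems by (auto elim: Cm_on_le)
    then show ?case
      by (intro Cm_on_SucI[OF \<open>open U\<close> has_derivative_mult[OF Cm_on_SucD(1) Cm_on_SucD(1)]])
        (use Suc.prems \<open>open U\<close> in
          \<open>auto simp del: hderiv.simps intro!: Cm_on_add Suc.IH Cm_on_SucD(2)\<close>)
  qed
  then show ?thesis
    using assms(2,3) Cm_on_iff_finite[of m] by blast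
qed

lemma Cm_on_diff:
  assumes "open U" "Cm_on m U f" "Cm_on m U g"
  shows "Cm_on m U (\<lambda>x. f x - g x)"
  using Cm_on_add[OF assms(1,2) Cm_on_mult[OF assms(1) Cm_on_const[OF assms(1), of m "-1"] assms(3)]]
  by simp

lemma Cm_on_sum:
  assumes "open U" "\<And>i. i \<in> I \<Longrightarrow> Cm_on m U (f i)"
  shows "Cm_on m U (\<lambda>x. \<Sum>i\<in>I. f i x)"
  using assms(2)
  by (induction I rule: infinite_finite_induct) (auto intro!: Cm_on_const Cm_on_add assms(1))

text \<open>
  Coinduction makes smoothness of a function a matter of finding a family of functions that
  contains it and is closed under differentiation.
\<close>

coinductive smooth :: "(real \<Rightarrow> real) \<Rightarrow> bool" where
  smoothI: "(\<And>x. (\<phi> has_real_derivative \<phi>' x) (at x)) \<Longrightarrow> smooth \<phi>' \<Longrightarrow> smooth \<phi>"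

lemma Cm_on_smooth_compose:
  assumes "open U" "smooth \<phi>" "Cm_on m U f"
  shows "Cm_on m U (\<lambda>x. \<phi> (f x))"
proof -
  have "Cm_on (enat n) U (\<lambda>x. \<phi> (f x))"
    if "smooth \<phi>" "Cm_on (enat n) U f" for n \<phi>
    using that
  proof (induction n arbitrary: \<phi>)
    case 0
    then obtain \<phi>' where "\<And>x. (\<phi> has_real_derivative \<phi>' x) (at x)"
      by (meson smooth.cases)
    then have "continuous_on UNIV \<phi>"
      by (meson DERIV_isCont continuous_at_imp_continuous_on)
    with 0 show ?case
      by (auto simp: Cm_on_0 simp flip: zero_enat_def intro: continuous_on_compose2)
  next
    case (Suc n)
    then obtain \<phi>' where d: "\<And>x. (\<phi> has_real_derivative \<phi>' x) (at x)" and s: "smooth \<phi>'"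
      by (meson smooth.cases)
    have "Cm_on (enat n) U f"
      using Suc.prems by (auto elim: Cm_on_le)
    then have "Cm_on (enat n) U (\<lambda>x. \<phi>' (f x))"
      using Suc.IH s by blast
    moreover have "((\<lambda>x. \<phi> (f x)) has_derivative (\<lambda>u. hderiv f [u] x * \<phi>' (f x))) (at x)"
      if "x \<in> U" for x
      using has_derivative_compose[OF Cm_on_SucD(1)[OF Suc.prems(2) that]
          d[of "f x", THEN has_field_derivative_imp_has_derivative]]
      by (simp add: mult.commute)
    ultimately show ?case
      by (intro Cm_on_SucI[OF \<open>open U\<close>, where f' = "\<lambda>x u. hderiv f [u] x * \<phi>' (f x)"])
        (use Suc.prems \<open>open U\<close> in
          \<open>auto simp del: hderiv.simps intro!: Cm_on_mult Cm_on_SucD(2)\<close>)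
  qed
  then show ?thesis
    using assms(2,3) Cm_on_iff_finite[of m] by blast
qed

section \<open>A smooth convex ramp\<close>

text \<open>
  The bump function $e^{-1/(x(1-x))}$ on $(0,1)$, multiplied by a polynomial and by a negative power
  of $x(1-x)$. The derivatives of the bump function all have this form.
\<close>

definition bump :: "real poly \<Rightarrow> nat \<Rightarrow> real \<Rightarrow> real" where
  "bump p k x = (if 0 < x \<and> x < 1
     then poly p x * exp (- 1 / (x * (1 - x))) / (x * (1 - x)) ^ k else 0)"

text \<open>
  The exponential series at $1/q$ dominates its term of index $k+2$.
\<close>

lemma exp_minus_inverse_le:
  fixes q :: real
  assumes "0 < q"
  shows "exp (- 1 / q) / q ^ k \<le> fact (k + 2) * q\<^sup>2"
proof -
  have "(\<Sum>n\<in>{k + 2}. inverse (fact n) * (1 / q) ^ n) \<le> exp (1 / q)"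
    unfolding exp_def real_scaleR_def
    using assms summable_exp[of "1 / q"] by (intro sum_le_suminf) auto
  moreover have inv: "inverse (inverse F * (1 / q) ^ (k + 2)) = F * q\<^sup>2 * q ^ k" for F
    by (simp add: power_add power_one_over field_simps power2_eq_square)
  ultimately have "inverse (exp (1 / q)) \<le> inverse (inverse (fact (k + 2)) * (1 / q) ^ (k + 2))"
    using assms by (intro le_imp_inverse_le) auto
  also have "\<dots> = fact (k + 2) * q\<^sup>2 * q ^ k"
    by (rule inv)
  finally show ?thesis
    using assms by (simp only: divide_le_eq zero_less_power if_True minus_divide_left[symmetric] exp_minus)
qed

text \<open>
  Quadratic decay at both ends of $(0,1)$, whatever the power in the denominator; it is what makes
  the derivative at the two gluing points vanish.
\<close>

lemma bump_quadratic_bound: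
  obtains M where "\<And>x. \<bar>bump p k x\<bar> \<le> M * x\<^sup>2" "\<And>x. \<bar>bump p k x\<bar> \<le> M * (x - 1)\<^sup>2"
proof -
  have "compact (poly p ` {0..1})"
    by (intro compact_continuous_image) (auto intro: continuous_intros)
  then obtain B where B: "\<And>x. x \<in> {0..1} \<Longrightarrow> \<bar>poly p x\<bar> \<le> B"
    by (metis (no_types, opaque_lifting) bounded_iff compact_imp_bounded imageI real_norm_def)
  have "0 \<le> B"
    using B[of 0] by auto
  let ?M = "B * fact (k + 2)"
  have *: "\<bar>bump p k x\<bar> \<le> ?M * (x * (1 - x))\<^sup>2" if "0 < x" "x < 1" for x
  proof -
    have "\<bar>bump p k x\<bar> = \<bar>poly p x\<bar> * (exp (- 1 / (x * (1 - x))) / (x * (1 - x)) ^ k)"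
      using that by (simp add: bump_def abs_mult)
    also have "\<dots> \<le> B * (fact (k + 2) * (x * (1 - x))\<^sup>2)"
      by (intro mult_mono B exp_minus_inverse_le) (use that \<open>0 \<le> B\<close> in auto)
    finally show ?thesis by simp
  qed
  have "\<bar>bump p k x\<bar> \<le> ?M * x\<^sup>2 \<and> \<bar>bump p k x\<bar> \<le> ?M * (x - 1)\<^sup>2" for x
  proof (cases "0 < x \<and> x < 1")
    case True
    have "(x * (1 - x))\<^sup>2 \<le> x\<^sup>2" "(x * (1 - x))\<^sup>2 \<le> (1 - x)\<^sup>2"
      using True by (auto intro!: power_mono simp: mult_le_cancel_left1 mult_le_cancel_right1)
    moreover have "(1 - x)\<^sup>2 = (x - 1)\<^sup>2"
      by (rule power2_commute)
    ultimately show ?thesis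
      using *[of x] True \<open>0 \<le> B\<close>
      by (smt (verit, best) fact_ge_zero mult_left_mono mult_nonneg_nonneg)
  qed (use \<open>0 \<le> B\<close> in \<open>auto simp: bump_def\<close>)
  then show ?thesis
    using that by blast
qed

lemma quadratic_bound_DERIV_0:
  fixes f :: "real \<Rightarrow> real"
  assumes "\<And>x. \<bar>f x\<bar> \<le> M * (x - a)\<^sup>2"
  shows "(f has_real_derivative 0) (at a)"
proof -
  have "f a = 0" using assms[of a] by simp
  have "((\<lambda>x. (f x - f a) / (x - a)) \<longlongrightarrow> 0) (at a)"
  proof (rule Lim_null_comparison)
    show "\<forall>\<^sub>F x in at a. norm ((f x - f a) / (x - a)) \<le> M * \<bar>x - a\<bar>"
      unfolding eventually_at_filter
    proof (intro always_eventually allI impI)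
      fix x assume "x \<noteq> a"
      then show "norm ((f x - f a) / (x - a)) \<le> M * \<bar>x - a\<bar>"
        using assms[of x] \<open>f a = 0\<close>
        by (simp add: divide_le_eq abs_divide mult.assoc power2_eq_square abs_mult_self_eq)
    qed
    show "((\<lambda>x. M * \<bar>x - a\<bar>) \<longlongrightarrow> 0) (at a)"
      by (auto intro!: tendsto_eq_intros)
  qed
  then show ?thesis
    by (simp add: has_field_derivative_iff)
qed

text \<open>
  The product rule inside $(0,1)$; at the end points, the quadratic bound.
\<close>

lemma bump_DERIV:
  defines "q \<equiv> [:0, 1, - 1:] :: real poly"
  shows "(bump p k has_real_derivative
     bump (pderiv p * q\<^sup>2 - smult (real k) (p * pderiv q * q) + p * pderiv q) (k + 2) x) (at x)"
    (is "(_ has_real_derivative bump ?r _ _) _")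
proof -
  have q: "poly q x = x * (1 - x)" "poly (pderiv q) x = 1 - 2 * x" for x
    by (auto simp: q_def pderiv_pCons algebra_simps)
  consider "x < 0 \<or> 1 < x" | "x = 0" | "x = 1" | "0 < x" "x < 1"
    by linarith
  then show ?thesis
  proof cases
    case 1
    have "((\<lambda>_. 0) has_real_derivative bump ?r (k + 2) x) (at x)"
      using 1 by (auto simp: bump_def)
    then show ?thesis
      by (rule has_field_derivative_transform_within_open[of _ _ _ "{..<0} \<union> {1<..}"])
        (use 1 in \<open>auto simp: bump_def\<close>)
  next
    case 2
    then show ?thesis
      using bump_quadratic_bound[of p k] quadratic_bound_DERIV_0[of "bump p k" _ 0]
      by (metis diff_zero bump_def less_irrefl)
  next
    case 3
    then show ?thesis
      using bump_quadratic_bound[of p k] quadratic_bound_DERIV_0[of "bump p k" _ 1]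
      by (metis bump_def less_irrefl)
  next
    case 4
    let ?q = "x * (1 - x)"
    let ?q = "x * (1 - x)"
    have "?q \<noteq> 0"
      using 4 by simp
    then have "((\<lambda>x. inverse (x * (1 - x)) ^ k) has_real_derivative
       - real k * (1 - 2 * x) * inverse ?q ^ (k + 1)) (at x)"
    proof (cases k)
      case (Suc l)
      have "((\<lambda>x. inverse (x * (1 - x))) has_real_derivative
         - (1 - 2 * x) * (inverse ?q)\<^sup>2) (at x)"
        using \<open>?q \<noteq> 0\<close>
        by (auto intro!: derivative_eq_intros simp: algebra_simps power2_eq_square)
      from DERIV_power_Suc[OF this, of l] show ?thesis
        unfolding Suc by (rule DERIV_cong) (simp add: power2_eq_square algebra_simps)
    qed simp
    moreover have "((\<lambda>x. exp (- inverse (x * (1 - x)))) has_real_derivative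
       exp (- inverse ?q) * ((1 - 2 * x) * (inverse ?q)\<^sup>2)) (at x)"
      using \<open>?q \<noteq> 0\<close>
      by (auto intro!: derivative_eq_intros simp: algebra_simps power2_eq_square)
    ultimately have "((\<lambda>x. poly p x * (exp (- inverse (x * (1 - x))) * inverse (x * (1 - x)) ^ k))
       has_real_derivative poly (pderiv p) x * (exp (- inverse ?q) * inverse ?q ^ k)
         + poly p x * (exp (- inverse ?q) * ((1 - 2 * x) * (inverse ?q)\<^sup>2) * inverse ?q ^ k
         + exp (- inverse ?q) * (- real k * (1 - 2 * x) * inverse ?q ^ (k + 1)))) (at x)"
      (is "(_ has_real_derivative ?D) _")
      by (intro DERIV_cong[OF DERIV_mult[OF poly_DERIV DERIV_mult]]) (auto simp: algebra_simps)
    moreover have "?D = bump ?r (k + 2) x"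
    proof -
      \<comment> \<open>With \<open>a\<close> standing for $x(1-x)$ and \<open>c\<close> for its inverse, this collects the derivative over the
        common power $(x(1-x))^{k+2}$.\<close>
      have "pp * (e * c ^ k) + P * (e * (d * c\<^sup>2) * c ^ k + e * (- K * d * c ^ (k + 1)))
          = (pp * a\<^sup>2 - K * (P * d * a) + P * d) * e * c ^ (k + 2)"
        if "a * c = 1" for a c e pp P d K :: real
      proof -
        have "a\<^sup>2 * c\<^sup>2 = 1"
          using that by (metis power_mult_distrib power_one)
        have "(pp * a\<^sup>2 - K * (P * d * a) + P * d) * e * c ^ (k + 2)
            = (pp * (a\<^sup>2 * c\<^sup>2) - K * (P * d) * (a * c) * c + P * d * c\<^sup>2) * e * c ^ k"
          by (simp add: power_add power2_eq_square algebra_simps)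
        then show ?thesis
          unfolding that \<open>a\<^sup>2 * c\<^sup>2 = 1\<close> by (simp add: algebra_simps)
      qed
      note id = this[where a = ?q and c = "inverse ?q" and e = "exp (- inverse ?q)"
          and d = "1 - 2 * x" and pp = "poly (pderiv p) x" and P = "poly p x" and K = "real k"]
      have "bump ?r (k + 2) x = poly ?r x * exp (- inverse ?q) * inverse ?q ^ (k + 2)"
        using 4 by (simp add: bump_def divide_inverse power_inverse power_mult_distrib)
      also have "poly ?r x
          = poly (pderiv p) x * ?q\<^sup>2 - real k * (poly p x * (1 - 2 * x) * ?q) + poly p x * (1 - 2 * x)"
        by (simp add: q)
      finally show ?thesis
        using id[OF right_inverse[OF \<open>?q \<noteq> 0\<close>]] by (simp only:)
    qed
    ultimately have "((\<lambda>x. poly p x * (exp (- inverse (x * (1 - x))) * inverse (x * (1 - x)) ^ k))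
       has_real_derivative bump ?r (k + 2) x) (at x)"
      by simp
    then show ?thesis
      by (rule has_field_derivative_transform_within_open[of _ _ _ "{0<..<1}"])
        (use 4 in \<open>auto simp: bump_def divide_inverse power_inverse power_mult_distrib\<close>)
  qed
qed

lemma smooth_bump: "smooth (bump p k)"
proof -
  have "smooth f" if "\<exists>p k. f = bump p k" for f
    using that
  proof (coinduction arbitrary: f)
    case smooth
    then show ?case
      using bump_DERIV by blast
  qed
  then show ?thesis by blast
qed

lemma continuous_imp_antiderivative:
  fixes f :: "real \<Rightarrow> real"
  assumes "\<And>x. isCont f x"
  obtains F where "\<And>x. (F has_real_derivative f x) (at x)"
proof -
  have "\<exists>F. \<forall>x. - \<infinity> < ereal x \<longrightarrow> ereal x < \<infinity> \<longrightarrow> (F has_vector_derivative f x) (at x)"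
    by (rule einterval_antiderivative) (simp_all add: assms)
  then show ?thesis
    using that by (auto simp: has_real_derivative_iff_has_vector_derivative)
qed

text \<open>
  A smooth convex substitute for the positive part $s^+$, up to the constant \<open>c\<close> on the right. It is
  the second antiderivative of the bump function, normalised so that its slope increases from
  0 to 1 on $[0,1]$.
\<close>

lemma smooth_ramp:
  obtains \<phi> :: "real \<Rightarrow> real" and c :: real
  where "smooth \<phi>" "convex_on UNIV \<phi>" "mono \<phi>" "\<And>s t. s \<le> t \<Longrightarrow> \<phi> t - \<phi> s \<le> t - s"
    "\<And>s. s \<le> 0 \<Longrightarrow> \<phi> s = 0" "\<And>s. 1 \<le> s \<Longrightarrow> \<phi> s = s - c"
proof -
  let ?b = "bump 1 0"
  have b: "?b x = (if 0 < x \<and> x < 1 then exp (- 1 / (x * (1 - x))) else 0)" for x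
    by (simp add: bump_def)
  have "isCont ?b x" for x
    by (rule DERIV_isCont[OF bump_DERIV])
  then obtain B where B: "\<And>x. (B has_real_derivative ?b x) (at x)"
    using continuous_imp_antiderivative[of "?b"] by blast
  have "B 0 < B 1"
  proof (rule DERIV_pos_imp_increasing_open[of 0 1 B])
    show "\<exists>y. (B has_real_derivative y) (at x) \<and> 0 < y" if "0 < x" "x < 1" for x
      by (intro exI conjI, rule B) (simp add: b that)
    show "continuous_on {0..1} B"
      by (intro continuous_at_imp_continuous_on ballI DERIV_isCont[OF B])
  qed simp
  define K where "K = B 1 - B 0"
  have "0 < K"
    using \<open>B 0 < B 1\<close> by (simp add: K_def)
  define \<phi>' where "\<phi>' = (\<lambda>x. (B x - B 0) / K)"
  have \<phi>': "(\<phi>' has_real_derivative ?b x / K) (at x)" for x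
    unfolding \<phi>'_def using \<open>0 < K\<close> by (auto intro!: derivative_eq_intros B)
  have "isCont \<phi>' x" for x
    by (rule DERIV_isCont[OF \<phi>'])
  then obtain P where P: "\<And>x. (P has_real_derivative \<phi>' x) (at x)"
    using continuous_imp_antiderivative[of "\<phi>'"] by blast
  define \<phi> where "\<phi> = (\<lambda>x. P x - P 0)"
  have \<phi>: "(\<phi> has_real_derivative \<phi>' x) (at x)" for x
    unfolding \<phi>_def by (auto intro!: derivative_eq_intros P)
  have mono': "\<phi>' s \<le> \<phi>' t" if "s \<le> t" for s t
    by (rule DERIV_nonneg_imp_nondecreasing[OF that]) (intro exI conjI, rule \<phi>', use \<open>0 < K\<close> in \<open>simp add: b\<close>)
  have lo: "\<phi>' s = 0" if "s \<le> 0" for s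
  proof -
    have "\<phi>' 0 \<le> \<phi>' s"
      by (rule DERIV_nonpos_imp_nonincreasing[OF that]) (intro exI conjI, rule \<phi>', use that in \<open>simp add: b\<close>)
    with mono'[OF that] have "\<phi>' s = \<phi>' 0"
      by simp
    then show ?thesis by (simp add: \<phi>'_def)
  qed
  have hi: "\<phi>' s = 1" if "1 \<le> s" for s
  proof -
    have "\<phi>' s \<le> \<phi>' 1"
      by (rule DERIV_nonpos_imp_nonincreasing[OF that]) (intro exI conjI, rule \<phi>', use that in \<open>simp add: b\<close>)
    with mono'[OF that] have "\<phi>' s = \<phi>' 1"
      by simp
    then show ?thesis using \<open>0 < K\<close> by (simp add: \<phi>'_def K_def)
  qed
  have bd: "0 \<le> \<phi>' s" "\<phi>' s \<le> 1" for s
    using lo[of s] hi[of s] mono'[of 0 s] mono'[of s 1] lo[of 0] hi[of 1] by linarith+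
  have "(\<lambda>x. ?b x / K) = bump [:1 / K:] 0"
    by (auto simp: bump_def)
  then have "smooth (\<lambda>x. ?b x / K)"
    using smooth_bump by simp
  show ?thesis
  proof (rule that)
    show "smooth \<phi>"
      by (rule smoothI[OF \<phi> smoothI[OF \<phi>' \<open>smooth (\<lambda>x. ?b x / K)\<close>]])
    show "convex_on UNIV \<phi>"
      by (rule f''_ge0_imp_convex[OF _ \<phi> \<phi>']) (use \<open>0 < K\<close> in \<open>auto simp: b\<close>)
    show "mono \<phi>"
      by (rule monoI, rule DERIV_nonneg_imp_nondecreasing[where f = \<phi>], assumption, intro exI conjI, rule \<phi>, rule bd)
    show "\<phi> t - \<phi> s \<le> t - s" if "s \<le> t" for s t
    proof -
      have "s - \<phi> s \<le> t - \<phi> t"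
        by (rule DERIV_nonneg_imp_nondecreasing[OF that], intro exI conjI, rule DERIV_diff[OF DERIV_ident \<phi>])
          (simp add: bd)
      then show ?thesis by simp
    qed
    show "\<phi> s = 0" if "s \<le> 0" for s
    proof -
      have "\<phi> s \<le> \<phi> 0"
        by (rule DERIV_nonneg_imp_nondecreasing[OF that]) (intro exI conjI, rule \<phi>, rule bd)
      moreover have "\<phi> 0 \<le> \<phi> s"
        by (rule DERIV_nonpos_imp_nonincreasing[OF that]) (intro exI conjI, rule \<phi>, simp add: lo)
      ultimately show ?thesis by (simp add: \<phi>_def)
    qed
    have \<phi>1: "((\<lambda>x. \<phi> x - x) has_real_derivative \<phi>' x - 1) (at x)" for x
      by (auto intro!: derivative_eq_intros \<phi>)
    show "\<phi> s = s - (1 - \<phi> 1)" if "1 \<le> s" for s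
    proof -
      have "\<phi> s - s \<le> \<phi> 1 - 1"
        by (rule DERIV_nonpos_imp_nonincreasing[OF that]) (intro exI conjI, rule \<phi>1, simp add: bd)
      moreover have "\<phi> 1 - 1 \<le> \<phi> s - s"
        by (rule DERIV_nonneg_imp_nondecreasing[OF that]) (intro exI conjI, rule \<phi>1, simp add: hi)
      ultimately show ?thesis by simp
    qed
  qed
qed

section \<open>Convexity by gluing and by smooth maxima\<close>

text \<open>
  The maximum principle: if \<open>F\<close> exceeded one of its chords, the difference would attain a positive
  maximum over the segment, and the midpoint inequality fails at the first point of maximum,
  since immediately before it the values are strictly smaller. The step \<open>h\<close> is only local, so the
  hypothesis can be checked piece by piece for a function defined by gluing.
\<close>

lemma locally_midpoint_convex_imp_convex:
  fixes F :: "'a::real_normed_vector \<Rightarrow> real"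
  assumes cont: "continuous_on UNIV F"
    and mid: "\<And>z. \<exists>\<delta>>0. \<forall>h. norm h < \<delta> \<longrightarrow> F z \<le> (F (z - h) + F (z + h)) / 2"
  shows "convex_on UNIV F"
proof (rule convex_onI)
  fix t :: real and a b :: 'a
  assume t: "0 < t" "t < 1"
  define p where "p s = F ((1 - s) *\<^sub>R a + s *\<^sub>R b) - ((1 - s) * F a + s * F b)" for s
  have "continuous_on {0..1} p"
    unfolding p_def by (intro continuous_intros continuous_on_compose2[OF cont]) auto
  moreover have "p 0 = 0" "p 1 = 0"
    by (auto simp: p_def)
  show "F ((1 - t) *\<^sub>R a + t *\<^sub>R b) \<le> (1 - t) * F a + t * F b"
  proof (rule ccontr)
    assume "\<not> ?thesis"
    then have "p t > 0" by (simp add: p_def)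
    obtain x where x: "x \<in> {0..1}" "\<And>y. y \<in> {0..1} \<Longrightarrow> p y \<le> p x"
      using continuous_attains_sup[OF _ _ \<open>continuous_on {0..1} p\<close>] by fastforce
    \<comment> \<open>\<open>s\<close> is the first maximum point; \<open>\<epsilon>\<close> keeps $s \pm \epsilon$ in $[0,1]$ and the step within \<open>\<delta>\<close>.\<close>
    let ?A = "{0..1} \<inter> p -` {p x}"
    have "closed ?A"
      using continuous_on_closed_vimage[of "{0..1}" p] \<open>continuous_on {0..1} p\<close>
      by (metis Int_commute closed_atLeastAtMost closed_singleton)
    then have "compact ?A"
      by (metis compact_Icc closed_Int_compact inf.idem inf_assoc inf_commute)
    moreover have "?A \<noteq> {}"
      using x(1) by auto
    ultimately obtain s where s: "s \<in> ?A" "\<And>y. y \<in> ?A \<Longrightarrow> s \<le> y"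
      using compact_attains_inf by meson
    have max: "p y \<le> p s" if "y \<in> {0..1}" for y
      using x(2)[OF that] s(1) by auto
    have "p s > 0"
      using max[of t] t \<open>p t > 0\<close> by auto
    with s(1) \<open>p 0 = 0\<close> \<open>p 1 = 0\<close> have "0 < s" "s < 1"
      by (auto simp: less_le)
    let ?z = "(1 - s) *\<^sub>R a + s *\<^sub>R b"
    obtain \<delta> where "\<delta> > 0"
      and \<delta>: "\<And>h. norm h < \<delta> \<Longrightarrow> F ?z \<le> (F (?z - h) + F (?z + h)) / 2"
      using mid by blast
    define \<epsilon> where "\<epsilon> = min (min s (1 - s)) (\<delta> / (1 + norm (b - a)) / 2)"
    have "\<epsilon> > 0"
      using \<open>\<delta> > 0\<close> \<open>0 < s\<close> \<open>s < 1\<close> by (simp add: \<epsilon>_def add_pos_nonneg)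
    have "\<epsilon> * norm (b - a) < \<delta>"
    proof -
      have "\<epsilon> * (1 + norm (b - a)) \<le> \<delta> / 2"
        unfolding \<epsilon>_def
        by (smt (verit, ccfv_SIG) field_sum_of_halves min.cobounded2 norm_ge_zero pos_le_divide_eq
            times_divide_eq_left divide_divide_eq_left mult.commute)
      then show ?thesis
        using \<open>\<epsilon> > 0\<close> \<open>\<delta> > 0\<close> by (simp add: algebra_simps)
    qed
    then have "F ?z \<le> (F (?z - \<epsilon> *\<^sub>R (b - a)) + F (?z + \<epsilon> *\<^sub>R (b - a))) / 2"
      using \<delta> \<open>\<epsilon> > 0\<close> by simp
    moreover have "?z - \<epsilon> *\<^sub>R (b - a) = (1 - (s - \<epsilon>)) *\<^sub>R a + (s - \<epsilon>) *\<^sub>R b"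
      "?z + \<epsilon> *\<^sub>R (b - a) = (1 - (s + \<epsilon>)) *\<^sub>R a + (s + \<epsilon>) *\<^sub>R b"
      by (simp_all add: algebra_simps)
    ultimately have "p s \<le> (p (s - \<epsilon>) + p (s + \<epsilon>)) / 2"
      by (simp add: p_def field_simps)
    moreover have "s - \<epsilon> \<in> {0..1}" "s + \<epsilon> \<in> {0..1}"
      using \<open>\<epsilon> > 0\<close> \<open>0 < s\<close> \<open>s < 1\<close> by (auto simp: \<epsilon>_def)
    moreover have "p (s - \<epsilon>) \<noteq> p s"
      using s(1) s(2)[of "s - \<epsilon>"] \<open>\<epsilon> > 0\<close> calculation(2) by auto
    ultimately show False
      using max[of "s - \<epsilon>"] max[of "s + \<epsilon>"] by auto
  qed
qed simp

text \<open>
  $h + \varphi(g - h)$ is a smooth version of $\max(g, h)$. The function $(x, y) \mapsto y + \varphi(x - y)$ is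
  jointly convex; it increases in \<open>x\<close> because $\varphi$ does, and in \<open>y\<close> because $\varphi$ has slope at most 1.
\<close>

lemma convex_on_smooth_max:
  assumes "convex_on S g" "convex_on S h" "convex_on UNIV \<phi>" "mono \<phi>"
    and lip: "\<And>s t. s \<le> t \<Longrightarrow> \<phi> t - \<phi> s \<le> t - s"
  shows "convex_on S (\<lambda>x. h x + \<phi> (g x - h x))"
proof (rule convex_onI)
  fix t x y assume t: "0 < (t::real)" "t < 1" and xy: "x \<in> S" "y \<in> S"
  let ?z = "(1 - t) *\<^sub>R x + t *\<^sub>R y" and ?G = "(1 - t) * g x + t * g y" and ?H = "(1 - t) * h x + t * h y"
  have G: "g ?z \<le> ?G" and H: "h ?z \<le> ?H"
    using t xy assms(1,2) by (auto intro: convex_onD)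
  have "h ?z + \<phi> (g ?z - h ?z) \<le> ?H + \<phi> (g ?z - ?H)"
    using lip[of "g ?z - ?H" "g ?z - h ?z"] H by simp
  also have "\<dots> \<le> ?H + \<phi> (?G - ?H)"
    using G monoD[OF \<open>mono \<phi>\<close>] by simp
  also have "?G - ?H = (1 - t) *\<^sub>R (g x - h x) + t *\<^sub>R (g y - h y)"
    by (simp add: algebra_simps)
  also have "\<phi> \<dots> \<le> (1 - t) * \<phi> (g x - h x) + t * \<phi> (g y - h y)"
    using t by (intro convex_onD[OF assms(3)]) auto
  finally show "h ?z + \<phi> (g ?z - h ?z) \<le>
      (1 - t) * (h x + \<phi> (g x - h x)) + t * (h y + \<phi> (g y - h y))"
    by (simp add: algebra_simps)
qed (use assms(1) in \<open>auto simp: convex_on_def\<close>)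

section \<open>Multilinearity and uniform continuity of the derivatives\<close>

text \<open>
  Multilinearity of $D^j g(x)$, in the form of an expansion of one slot in the basis. For the slot
  of the last derivative this is linearity of a Frechet derivative; for the others the expansion
  holds on the open set \<open>U\<close> and is differentiated further.
\<close>

lemma hderiv_slot_linear:
  assumes "open U" "Cm_on m U g" "enat (length (us @ u # ws)) \<le> m" "x \<in> U"
  shows "hderiv g (us @ u # ws) x = (\<Sum>b\<in>Basis. (u \<bullet> b) * hderiv g (us @ b # ws) x)"
  using assms(3,4)
proof (induction us arbitrary: x)
  case Nil
  then have "enat (length ws) < m"
    by (simp add: Suc_ile_eq)
  define L where "L = (\<lambda>u. hderiv g (u # ws) x)"
  have "linear L"
    using hderiv_has_derivative[OF assms(2) \<open>enat (length ws) < m\<close> Nil(2)]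
    unfolding L_def by (rule has_derivative_linear)
  then have "L (\<Sum>b\<in>Basis. (u \<bullet> b) *\<^sub>R b) = (\<Sum>b\<in>Basis. (u \<bullet> b) * L b)"
    by (simp add: linear_sum linear_scale)
  then show ?case
    by (simp add: L_def euclidean_representation del: hderiv.simps)
next
  case (Cons v us)
  have "enat (length (us @ u # ws)) \<le> m" and l: "enat (length (us @ b # ws)) < m" for b
    using Cons.prems(1) order_less_trans[of "enat (length us + length ws)" "enat (Suc (length us + length ws))" m]
    by (auto simp: Suc_ile_eq)
  then have IH: "hderiv g (us @ u # ws) y = (\<Sum>b\<in>Basis. (u \<bullet> b) * hderiv g (us @ b # ws) y)"
    if "y \<in> U" for y
    using Cons.IH that by blast
  have "((\<lambda>y. \<Sum>b\<in>Basis. (u \<bullet> b) * hderiv g (us @ b # ws) y) has_derivative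
      (\<lambda>v. \<Sum>b\<in>Basis. (u \<bullet> b) * hderiv g (v # us @ b # ws) x)) (at x)"
    by (intro has_derivative_sum has_derivative_mult_right hderiv_has_derivative[OF assms(2)] l Cons.prems)
  then have "(hderiv g (us @ u # ws) has_derivative
      (\<lambda>v. \<Sum>b\<in>Basis. (u \<bullet> b) * hderiv g (v # us @ b # ws) x)) (at x)"
    by (rule has_derivative_transform_within_open[OF _ \<open>open U\<close> Cons.prems(2)]) (simp add: IH)
  then show ?case
    by (simp add: frechet_derivative_at[symmetric])
qed

lemma hderiv_slot_scaleR:
  assumes "open U" "Cm_on m U g" "enat (length (us @ u # ws)) \<le> m" "x \<in> U"
  shows "hderiv g (us @ (c *\<^sub>R u) # ws) x = c * hderiv g (us @ u # ws) x"
  using hderiv_slot_linear[OF assms] hderiv_slot_linear[OF assms(1,2) _ assms(4), of us "c *\<^sub>R u" ws]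
    assms(3) by (simp add: sum_distrib_left mult.assoc)

text \<open>
  Continuity of each of the scalar functions $D^j g(\cdot)(u_1, \dots, u_j)$ becomes uniform over all
  directions in the unit ball, because by multilinearity only finitely many of these functions
  matter, those for basis vectors. The induction reduces
  the slots one by one, from the end of the list, and \<open>ws\<close> collects those already reduced.
\<close>

lemma hderiv_uniformly_equicontinuous:
  assumes "open U" "Cm_on m U g" "compact K" "K \<subseteq> U" "0 < \<epsilon>" "enat (j + length ws) \<le> m"
  shows "\<exists>\<delta>>0. \<forall>us x y. length us = j \<and> (\<forall>u\<in>set us. norm u \<le> 1) \<and> x \<in> K \<and> y \<in> K \<and> dist x y < \<delta> \<longrightarrow>
     \<bar>hderiv g (us @ ws) x - hderiv g (us @ ws) y\<bar> < \<epsilon>"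
  using assms(5,6)
proof (induction j arbitrary: ws \<epsilon>)
  case 0
  then have "continuous_on K (hderiv g ws)"
    using assms unfolding Cm_on_def by (auto intro: continuous_on_subset)
  then have "uniformly_continuous_on K (hderiv g ws)"
    using \<open>compact K\<close> compact_uniformly_continuous by blast
  then show ?case
    using 0 unfolding uniformly_continuous_on_def by (fastforce simp: dist_real_def)
next
  case (Suc j)
  let ?N = "real DIM('a)"
  have "0 < \<epsilon> / ?N" using Suc.prems by simp
  have "\<exists>\<delta>>0. \<forall>us x y. length us = j \<and> (\<forall>u\<in>set us. norm u \<le> 1) \<and> x \<in> K \<and> y \<in> K \<and> dist x y < \<delta> \<longrightarrow>
     \<bar>hderiv g (us @ b # ws) x - hderiv g (us @ b # ws) y\<bar> < \<epsilon> / ?N" for b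
    using Suc.IH[of "\<epsilon> / ?N" "b # ws"] Suc.prems by simp
  then obtain d where d0: "\<And>b. d b > 0" and d: "\<And>b us x y. length us = j \<Longrightarrow> (\<forall>u\<in>set us. norm u \<le> 1) \<Longrightarrow>
      x \<in> K \<Longrightarrow> y \<in> K \<Longrightarrow> dist x y < d b \<Longrightarrow>
     \<bar>hderiv g (us @ b # ws) x - hderiv g (us @ b # ws) y\<bar> < \<epsilon> / ?N"
    by metis
  define \<delta> where "\<delta> = Min (d ` Basis)"
  have "\<delta> > 0" "\<And>b. b \<in> Basis \<Longrightarrow> \<delta> \<le> d b"
    using d0 by (auto simp: \<delta>_def)
  moreover have "\<bar>hderiv g (us @ ws) x - hderiv g (us @ ws) y\<bar> < \<epsilon>"
    if us: "length us = Suc j" "\<forall>u\<in>set us. norm u \<le> 1" and xy: "x \<in> K" "y \<in> K" "dist x y < \<delta>" for us x y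
  proof -
    obtain vs u where vs: "us = vs @ [u]" "length vs = j"
      using us(1) by (metis length_Suc_conv_rev)
    have "hderiv g (us @ ws) z = (\<Sum>b\<in>Basis. (u \<bullet> b) * hderiv g (vs @ b # ws) z)" if "z \<in> K" for z
      using hderiv_slot_linear[OF assms(1,2), of vs u ws z] Suc.prems vs that \<open>K \<subseteq> U\<close> by auto
    then have "\<bar>hderiv g (us @ ws) x - hderiv g (us @ ws) y\<bar>
       = \<bar>\<Sum>b\<in>Basis. (u \<bullet> b) * (hderiv g (vs @ b # ws) x - hderiv g (vs @ b # ws) y)\<bar>"
      using xy by (simp add: sum_subtractf right_diff_distrib)
    also have "\<dots> \<le> (\<Sum>b\<in>Basis. \<bar>(u \<bullet> b) * (hderiv g (vs @ b # ws) x - hderiv g (vs @ b # ws) y)\<bar>)"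
      by (rule sum_abs)
    also have "\<dots> < (\<Sum>b\<in>(Basis::'a set). \<epsilon> / ?N)"
    proof (rule sum_strict_mono)
      fix b :: 'a assume b: "b \<in> Basis"
      have "\<bar>u \<bullet> b\<bar> \<le> 1"
        using Basis_le_norm[OF b, of u] us(2) vs by auto
      then have "\<bar>(u \<bullet> b) * (hderiv g (vs @ b # ws) x - hderiv g (vs @ b # ws) y)\<bar>
          \<le> \<bar>hderiv g (vs @ b # ws) x - hderiv g (vs @ b # ws) y\<bar>"
        by (simp add: abs_mult mult_left_le_one_le)
      also have "\<dots> < \<epsilon> / ?N"
        using d[of vs x y b] vs us xy calculation b \<open>\<And>b. b \<in> Basis \<Longrightarrow> \<delta> \<le> d b\<close> by fastforce
      finally show "\<bar>(u \<bullet> b) * (hderiv g (vs @ b # ws) x - hderiv g (vs @ b # ws) y)\<bar> < \<epsilon> / ?N" .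
    qed auto
    finally show ?thesis by simp
  qed
  ultimately show ?case by blast
qed

section \<open>Convexity on a neighbourhood from the strict inequality\<close>

lemma hderiv_along_line:
  assumes "Cm_on m U g" "enat (length us) < m" "y + s *\<^sub>R w \<in> U"
  shows "((\<lambda>s. hderiv g us (y + s *\<^sub>R w)) has_real_derivative hderiv g (w # us) (y + s *\<^sub>R w)) (at s)"
proof -
  have "((\<lambda>s. y + s *\<^sub>R w) has_vector_derivative w) (at s)"
    by (auto intro!: derivative_eq_intros)
  from vector_derivative_diff_chain_within[OF this has_derivative_at_withinI[OF hderiv_has_derivative[OF assms]]]
  show ?thesis
    by (simp add: has_real_derivative_iff_has_vector_derivative o_def del: hderiv.simps)
qed

text \<open>
  For \<open>y\<close> in \<open>C\<close> and a unit vector \<open>w\<close>, Taylor expansion of $t \mapsto D^2g(y + tw)(v^2)$ to order $k-2$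
  gives the sum in $(CW^k)$ plus an error, which is the oscillation of $D^kg(\cdot)(w^{k-2}, v^2)$ times
  $t^{k-2}/(k-2)!$. Uniform continuity makes the error at most $\eta t^{k-2}$ for small \<open>t\<close>, uniformly in
  \<open>y\<close>, \<open>v\<close>, \<open>w\<close>, and it is then absorbed by the strict inequality. Every point near \<open>C\<close> and outside it
  is of the form $y + tw$, with \<open>y\<close> a nearest point of \<open>C\<close>; points of \<open>C\<close> itself are limits of points
  of the form $y + tw$.
\<close>

lemma CW_strict_imp_second_derivative_nonneg:
  assumes "closed C" "C \<noteq> {}"
    and U: "open U" "{x. infdist x C \<le> \<rho>} \<subseteq> U" "compact {x. infdist x C \<le> \<rho>}" "0 < \<rho>"
    and g: "Cm_on m U g" and k: "2 \<le> k" "enat k \<le> m" and "CW_strict k C g"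
  obtains r where "0 < r" "r \<le> \<rho>" "\<And>x v. infdist x C < r \<Longrightarrow> 0 \<le> hderiv g [v, v] x"
proof -
  let ?K = "{x. infdist x C \<le> \<rho>}"
  from \<open>CW_strict k C g\<close> obtain \<eta> t0 where "0 < \<eta>" "0 < t0" and
    CW: "\<And>y v w t. y \<in> C \<Longrightarrow> norm v = 1 \<Longrightarrow> norm w = 1 \<Longrightarrow> 0 < t \<Longrightarrow> t \<le> t0 \<Longrightarrow>
      \<eta> * t ^ (k - 2) \<le> (\<Sum>j=2..k. t ^ (j - 2) / fact (j - 2) * hderiv g (replicate (j - 2) w @ [v, v]) y)"
    unfolding CW_strict_def by auto
  define n where "n = k - 2"
  have kn: "k = n + 2" using k by (simp add: n_def)
  \<comment> \<open>The sum of $(CW^k)$ reindexed from 0, with its top term apart, to match the Taylor formula with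
    Lagrange remainder.\<close>
  have CW': "\<eta> * t ^ n \<le> (\<Sum>j<n. hderiv g (replicate j w @ [v, v]) y / fact j * t ^ j)
      + hderiv g (replicate n w @ [v, v]) y / fact n * t ^ n"
    if "y \<in> C" "norm v = 1" "norm w = 1" "0 < t" "t \<le> t0" for y v w t
  proof -
    have "{2..k} = (\<lambda>j. j + 2) ` {..n}"
      using image_add_atLeastAtMost'[of 2 0 n] by (simp only: kn atMost_atLeast0 add_0_left)
    then have "(\<Sum>j=2..k. t ^ (j - 2) / fact (j - 2) * hderiv g (replicate (j - 2) w @ [v, v]) y)
        = (\<Sum>j\<le>n. t ^ j / fact j * hderiv g (replicate j w @ [v, v]) y)"
      by (simp only:) (subst sum.reindex, auto simp: o_def inj_on_def simp del: hderiv.simps)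
    also have "\<dots> = (\<Sum>j<n. t ^ j / fact j * hderiv g (replicate j w @ [v, v]) y)
        + t ^ n / fact n * hderiv g (replicate n w @ [v, v]) y"
      by (simp add: lessThan_Suc_atMost[symmetric] del: hderiv.simps)
    finally show ?thesis
      using CW[OF that] by (simp add: n_def mult_ac divide_inverse del: hderiv.simps)
  qed
  obtain \<delta> where "0 < \<delta>" and \<delta>: "\<And>us x y. length us = k \<Longrightarrow> \<forall>u\<in>set us. norm u \<le> 1 \<Longrightarrow>
      x \<in> ?K \<Longrightarrow> y \<in> ?K \<Longrightarrow> dist x y < \<delta> \<Longrightarrow> \<bar>hderiv g us x - hderiv g us y\<bar> < \<eta>"
    using hderiv_uniformly_equicontinuous[OF U(1) g U(3,2) \<open>0 < \<eta>\<close>, of k "[]"] k by auto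
  define r where "r = min (min \<rho> t0) \<delta>"
  have "0 < r" "r \<le> \<rho>" using \<open>0 < \<delta>\<close> \<open>0 < t0\<close> \<open>0 < \<rho>\<close> by (auto simp: r_def)
  have outside: "0 \<le> hderiv g [v, v] (y + t *\<^sub>R w)"
    if y: "y \<in> C" "norm w = 1" "norm v = 1" "0 < t" "t < r" for y t w v
  proof -
    have K: "y + s *\<^sub>R w \<in> ?K" "dist (y + s *\<^sub>R w) y \<le> s" if "0 \<le> s" "s \<le> t" for s
    proof -
      show "dist (y + s *\<^sub>R w) y \<le> s"
        using that y by (simp add: dist_norm)
      then have "infdist (y + s *\<^sub>R w) C \<le> s"
        using y(1) by (meson infdist_le order_trans)
      then show "y + s *\<^sub>R w \<in> ?K"
        using that y \<open>r \<le> \<rho>\<close> by simp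
    qed
    have "((\<lambda>s. hderiv g (replicate j w @ [v, v]) (y + s *\<^sub>R w)) has_real_derivative
        hderiv g (replicate (Suc j) w @ [v, v]) (y + s *\<^sub>R w)) (at s)"
      if "j < n" "0 \<le> s" "s \<le> t" for j s
    proof -
      have "enat (length (replicate j w @ [v, v])) < m"
        using k kn that(1) by (metis add_less_cancel_right enat_ord_simps(2) length_append length_replicate
            list.size(3,4) order_less_le_trans numeral_2_eq_2 One_nat_def plus_1_eq_Suc add.commute)
      from hderiv_along_line[OF g this, of y s w] show ?thesis
        using K(1)[of s] that U(2) by auto
    qed
    then obtain s where s: "0 < s" "s \<le> t" and
      T: "hderiv g [v, v] (y + t *\<^sub>R w)
        = (\<Sum>j<n. hderiv g (replicate j w @ [v, v]) (y + 0 *\<^sub>R w) / fact j * t ^ j)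
         + hderiv g (replicate n w @ [v, v]) (y + s *\<^sub>R w) / fact n * t ^ n"
      using Maclaurin2[OF \<open>0 < t\<close>, of "\<lambda>j s. hderiv g (replicate j w @ [v, v]) (y + s *\<^sub>R w)"
          "\<lambda>s. hderiv g [v, v] (y + s *\<^sub>R w)" n] by (auto simp del: hderiv.simps)
    let ?d = "hderiv g (replicate n w @ [v, v]) y - hderiv g (replicate n w @ [v, v]) (y + s *\<^sub>R w)"
    have "\<bar>?d\<bar> < \<eta>"
      using \<delta>[of "replicate n w @ [v, v]" y "y + s *\<^sub>R w"] K[of s] K[of 0] s y kn
      by (auto simp: r_def dist_commute simp del: hderiv.simps)
    moreover have "\<bar>?d\<bar> / fact n \<le> \<bar>?d\<bar>"
      by (simp add: divide_le_eq mult_le_cancel_left1 del: hderiv.simps)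
    ultimately have "?d / fact n \<le> \<eta>"
      by (smt (verit) divide_right_mono fact_ge_zero)
    then have "?d / fact n * t ^ n \<le> \<eta> * t ^ n"
      using \<open>0 < t\<close> by (intro mult_right_mono) auto
    moreover have "t \<le> t0" using \<open>t < r\<close> by (simp add: r_def)
    ultimately show ?thesis
      using CW'[OF y(1) y(3) y(2) y(4)] T
      by (simp add: diff_divide_distrib left_diff_distrib del: hderiv.simps)
  qed
  have nonneg: "0 \<le> hderiv g [v, v] x" if "infdist x C < r" "norm v = 1" for x v
  proof (cases "x \<in> C")
    case False
    obtain y where "y \<in> C" "infdist x C = dist x y"
      using infdist_attains_inf[OF \<open>closed C\<close> \<open>C \<noteq> {}\<close>] by blast
    then have "0 < norm (x - y)" "norm (x - y) < r"
      using False that(1) by (auto simp: dist_norm)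
    then show ?thesis
      using outside[of y "(x - y) /\<^sub>R norm (x - y)" v "norm (x - y)"] \<open>y \<in> C\<close> that(2) by simp
  next
    case True
    have "x \<in> U" using True U(2,4) by auto
    have "continuous_on U (hderiv g [v, v])"
      using g k unfolding Cm_on_def 
      by (metis (no_types, lifting) One_nat_def enat_ord_simps(1) length_Cons list.size(3) numeral_2_eq_2 order_trans)
    then have c: "isCont (hderiv g [v, v]) x"
      using \<open>open U\<close> \<open>x \<in> U\<close> continuous_on_eq_continuous_at by blast
    \<comment> \<open>Any unit vector serves as the direction of approach; \<open>v\<close> is at hand.\<close>
    have "((\<lambda>t. x + t *\<^sub>R v) \<longlongrightarrow> x) (at_right 0)"
      by (auto intro!: tendsto_eq_intros)
    then have "((\<lambda>t. hderiv g [v, v] (x + t *\<^sub>R v)) \<longlongrightarrow> hderiv g [v, v] x) (at_right 0)"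
      using c isCont_tendsto_compose by blast
    moreover have "eventually (\<lambda>t. 0 \<le> hderiv g [v, v] (x + t *\<^sub>R v)) (at_right 0)"
      using outside[OF True] that(2) \<open>0 < r\<close> unfolding eventually_at_right_field by blast
    ultimately show ?thesis
      by (rule tendsto_lowerbound) simp
  qed
  have "0 \<le> hderiv g [v, v] x" if x: "infdist x C < r" for x v
  proof (cases "v = 0")
    case False
    have "x \<in> U" using x U(2) \<open>r \<le> \<rho>\<close> by auto
    let ?u = "v /\<^sub>R norm v" let ?c = "norm v"
    have v: "v = ?c *\<^sub>R ?u" using False by simp
    have le: "enat 2 \<le> m"
      using k by (meson enat_ord_simps(1) order_trans)
    have "hderiv g [v, v] x = ?c * (?c * hderiv g [?u, ?u] x)"
      using hderiv_slot_scaleR[OF U(1) g _ \<open>x \<in> U\<close>, of "[]" ?u "[v]" ?c]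
        hderiv_slot_scaleR[OF U(1) g _ \<open>x \<in> U\<close>, of "[?u]" ?u "[]" ?c] le v
      by (simp add: numeral_2_eq_2 del: hderiv.simps)
    then show ?thesis
      using nonneg[OF x, of ?u] False by (simp del: hderiv.simps)
  next
    case True
    have "x \<in> U" using x U(2) \<open>r \<le> \<rho>\<close> by auto
    have le: "enat 2 \<le> m"
      using k by (meson enat_ord_simps(1) order_trans)
    show ?thesis
      using hderiv_slot_scaleR[OF U(1) g _ \<open>x \<in> U\<close>, of "[]" v "[v]" 0] le True
      by (simp add: numeral_2_eq_2 del: hderiv.simps)
  qed
  with that \<open>0 < r\<close> \<open>r \<le> \<rho>\<close> show ?thesis by blast
qed

lemma second_derivative_nonneg_imp_convex_on:
  assumes "Cm_on m U g" "2 \<le> m" "convex V" "V \<subseteq> U"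
    and nonneg: "\<And>x v. x \<in> V \<Longrightarrow> 0 \<le> hderiv g [v, v] x"
  shows "convex_on V g"
proof (rule convex_onI)
  fix t :: real and a b assume t: "0 < t" "t < 1" and ab: "a \<in> V" "b \<in> V"
  let ?l = "\<lambda>s. a + s *\<^sub>R (b - a)"
  have l: "?l s \<in> V" if "s \<in> {0..1}" for s
    using convexD_alt[OF \<open>convex V\<close> ab, of s] that by (simp add: algebra_simps)
  have D: "((\<lambda>s. hderiv g us (?l s)) has_real_derivative hderiv g ((b - a) # us) (?l s)) (at s)"
    if "length us < 2" "s \<in> {0..1}" for us s
    by (rule hderiv_along_line[OF assms(1)])
      (use l[OF that(2)] assms(2,4) that(1) in \<open>auto intro: less_le_trans[of _ "enat 2"] simp: numeral_eq_enat\<close>)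
  have "convex_on {0..1} (\<lambda>s. g (?l s))"
    by (rule f''_ge0_imp_convex[OF _ D[of "[]", unfolded hderiv.simps(1)] D[of "[b - a]"]])
      (auto simp del: hderiv.simps(2) intro!: nonneg l)
  from convex_onD[OF this, of t 0 1] t
  show "g ((1 - t) *\<^sub>R a + t *\<^sub>R b) \<le> (1 - t) * g a + t * g b"
    by (simp add: algebra_simps)
qed fact

text \<open>
  The neighbourhood is the Minkowski sum of \<open>C\<close> and a ball.
\<close>

lemma convex_infdist_less:
  fixes C :: "'a::euclidean_space set"
  assumes "convex C" "closed C" "C \<noteq> {}"
  shows "convex {x. infdist x C < r}"
proof -
  have "{x. infdist x C < r} = (\<Union>x\<in>C. \<Union>y\<in>ball 0 r. {x + y})"
  proof (intro set_eqI iffI)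
    fix x assume "x \<in> {x. infdist x C < r}"
    moreover obtain y where "y \<in> C" "infdist x C = dist x y"
      using infdist_attains_inf[OF assms(2,3)] by blast
    ultimately have "x - y \<in> ball 0 r" "x = y + (x - y)"
      by (auto simp: dist_norm norm_minus_commute)
    with \<open>y \<in> C\<close> show "x \<in> (\<Union>x\<in>C. \<Union>y\<in>ball 0 r. {x + y})"
      by blast
  next
    fix x assume "x \<in> (\<Union>x\<in>C. \<Union>y\<in>ball 0 r. {x + y})"
    then obtain y z where "y \<in> C" "norm z < r" "x = y + z"
      by auto
    then show "x \<in> {x. infdist x C < r}"
      using infdist_le2[of y C x "norm z"] by (auto simp: dist_norm)
  qed
  then show ?thesis
    using convex_sums[OF \<open>convex C\<close> convex_ball] by simp
qed

section \<open>Extension from a neighbourhood to the whole space\<close>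

text \<open>
  Finitely many open half-spaces that avoid \<open>C\<close> cover the compact set \<open>S\<close>. Composing a suitably scaled
  affine function for each of them with the smooth ramp, and adding up, gives the required function.
\<close>

lemma smooth_convex_function_vanishing_on:
  fixes C S :: "'a::euclidean_space set"
  assumes "convex C" "closed C" "compact S" "C \<inter> S = {}"
  obtains \<psi> where "\<And>m. Cm_on m UNIV \<psi>" "convex_on UNIV \<psi>" "\<And>x. 0 \<le> \<psi> x"
    "\<And>x. x \<in> C \<Longrightarrow> \<psi> x = 0" "\<And>x. x \<in> S \<Longrightarrow> 1 \<le> \<psi> x"
proof -
  obtain \<phi> c where \<phi>: "smooth \<phi>" "convex_on UNIV \<phi>" "mono \<phi>"
    "\<And>s. s \<le> 0 \<Longrightarrow> \<phi> s = 0" "\<And>s. 1 \<le> s \<Longrightarrow> \<phi> s = s - c"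
    using smooth_ramp by metis
  \<comment> \<open>Chosen so that \<open>\<phi> T = T - c\<close>, which is at least 1.\<close>
  define T where "T = max 1 (1 + c)"
  have "\<phi> T \<ge> 1" "T > 0" using \<phi>(5)[of T] by (auto simp: T_def)
  have pos: "0 \<le> \<phi> s" for s
    using \<phi>(4)[of "min s 0"] monoD[OF \<phi>(3), of "min s 0" s] by simp
  \<comment> \<open>Separation gives a positive gap $b - a \cdot x$; scaling by \<open>\<alpha>\<close> raises it to $2T$.\<close>
  have "\<exists>a b. T < inner a x - b \<and> (\<forall>z\<in>C. inner a z - b \<le> 0)" if "x \<in> S" for x
  proof -
    have "x \<notin> C" using that assms(4) by blast
    then obtain a b where ab: "inner a x < b" "\<forall>z\<in>C. b < inner a z"
      using separating_hyperplane_closed_point[OF assms(1,2)] by blast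
    define \<alpha> where "\<alpha> = 2 * T / (b - inner a x)"
    have "\<alpha> > 0" "\<alpha> * (b - inner a x) = 2 * T"
      using ab(1) \<open>T > 0\<close> by (auto simp: \<alpha>_def)
    then have "T < inner (- \<alpha> *\<^sub>R a) x - (- \<alpha> * b)"
      using \<open>T > 0\<close> by (simp add: algebra_simps)
    moreover have "inner (- \<alpha> *\<^sub>R a) z - (- \<alpha> * b) \<le> 0" if "z \<in> C" for z
      using mult_left_mono[of b "inner a z" \<alpha>] ab(2) that \<open>\<alpha> > 0\<close> by (simp add: less_imp_le)
    ultimately show ?thesis by blast
  qed
  then obtain a b where ab: "\<And>x. x \<in> S \<Longrightarrow> T < inner (a x) x - b x"
    "\<And>x z. x \<in> S \<Longrightarrow> z \<in> C \<Longrightarrow> inner (a x) z - b x \<le> 0"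
    by metis
  have "open {z. T < inner (a x) z - b x}" for x
    by (intro open_Collect_less continuous_intros)
  moreover have "S \<subseteq> (\<Union>x\<in>S. {z. T < inner (a x) z - b x})"
    using ab(1) by auto
  ultimately obtain D where D: "D \<subseteq> S" "finite D" "S \<subseteq> (\<Union>x\<in>D. {z. T < inner (a x) z - b x})"
    by (rule compactE_image[OF \<open>compact S\<close>])
  define \<psi> where "\<psi> = (\<lambda>z. \<Sum>x\<in>D. \<phi> (inner (a x) z - b x))"
  show ?thesis
  proof (rule that)
    show "Cm_on m UNIV \<psi>" for m
    proof -
      have "Cm_on m UNIV (\<lambda>z. inner (a x) z - b x)" for x
        by (rule Cm_on_diff[OF open_UNIV Cm_on_bounded_linear[OF open_UNIV bounded_linear_inner_right]
            Cm_on_const[OF open_UNIV]])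
      then show ?thesis
        unfolding \<psi>_def by (rule Cm_on_sum[OF open_UNIV Cm_on_smooth_compose[OF open_UNIV \<phi>(1)]])
    qed
    have "convex_on UNIV (\<lambda>z. \<phi> (inner (a x) z - b x))" for x
    proof (rule convex_onI)
      fix t y z assume t: "0 < (t::real)" "t < 1"
      have "inner (a x) ((1 - t) *\<^sub>R y + t *\<^sub>R z) - b x
          = (1 - t) *\<^sub>R (inner (a x) y - b x) + t *\<^sub>R (inner (a x) z - b x)"
        by (simp add: inner_right_distrib algebra_simps)
      then show "\<phi> (inner (a x) ((1 - t) *\<^sub>R y + t *\<^sub>R z) - b x)
          \<le> (1 - t) * \<phi> (inner (a x) y - b x) + t * \<phi> (inner (a x) z - b x)"
        using convex_onD[OF \<phi>(2), of t "inner (a x) y - b x" "inner (a x) z - b x"] t by simp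
    qed simp
    then show "convex_on UNIV \<psi>"
      unfolding \<psi>_def using D(2)
      by - (induction rule: finite_induct[OF D(2)], auto intro: convex_on_add simp: convex_on_const)
    show "0 \<le> \<psi> x" for x
      unfolding \<psi>_def by (intro sum_nonneg pos)
    show "\<psi> x = 0" if "x \<in> C" for x
      unfolding \<psi>_def using ab(2) that D(1) \<phi>(4) by (intro sum.neutral) blast
    show "1 \<le> \<psi> x" if "x \<in> S" for x
    proof -
      obtain y where y: "y \<in> D" "T < inner (a y) x - b y"
        using D(3) \<open>x \<in> S\<close> by blast
      have "1 \<le> \<phi> (inner (a y) x - b y)"
        using monoD[OF \<phi>(3), of T "inner (a y) x - b y"] y(2) \<open>\<phi> T \<ge> 1\<close> by simp
      also have "\<dots> \<le> \<psi> x"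
        unfolding \<psi>_def using y(1) D(2) pos by (intro member_le_sum) auto
      finally show ?thesis .
    qed
  qed
qed

text \<open>
  A convex $C^m$ function near \<open>C\<close> is glued to a convex smooth function \<open>H\<close> on the whole space. The
  latter is at most $g - 1$ on \<open>C\<close> and at least \<open>g\<close> on a shell \<open>S\<close> around \<open>C\<close>. The smooth maximum of \<open>g\<close> and
  \<open>H\<close> is therefore $g - c$ on \<open>C\<close> and \<open>H\<close> on \<open>S\<close>, so that it continues by \<open>H\<close> beyond the shell. The
  result \<open>F\<close> is convex near each point inside the shell, and at all other points it touches
  the convex function \<open>H\<close>, which lies below it everywhere.
\<close>

lemma convex_extension_from_neighbourhood:
  fixes C :: "'a::euclidean_space set"
  assumes C: "convex C" "compact C" "C \<noteq> {}" and "0 < r"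
    and g: "Cm_on m {x. infdist x C < r} g" "convex_on {x. infdist x C < r} g"
  obtains F where "convex_on UNIV F" "Cm_on m UNIV F" "\<And>x. x \<in> C \<Longrightarrow> F x = g x"
proof -
  let ?N = "\<lambda>s. {x. infdist x C < s}"
  have oN: "open (?N s)" for s
    by (intro open_Collect_less continuous_intros)
  define K where "K = {x. infdist x C \<le> r / 2}"
  define S where "S = {x \<in> K. r / 4 \<le> infdist x C}"
  have "compact K"
    unfolding K_def using C \<open>0 < r\<close> by (intro compact_infdist_le) auto
  moreover have "closed {x. r / 4 \<le> infdist x C}"
    by (intro closed_Collect_le continuous_intros)
  ultimately have "compact S"
    unfolding S_def by (metis Collect_conj_eq Collect_mem_eq compact_Int_closed)
  have "C \<inter> S = {}"
    using \<open>0 < r\<close> by (auto simp: S_def)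
  obtain \<psi> where \<psi>: "\<And>m. Cm_on m UNIV \<psi>" "convex_on UNIV \<psi>" "\<And>x. 0 \<le> \<psi> x"
    "\<And>x. x \<in> C \<Longrightarrow> \<psi> x = 0" "\<And>x. x \<in> S \<Longrightarrow> 1 \<le> \<psi> x"
    using smooth_convex_function_vanishing_on[OF C(1) compact_imp_closed[OF C(2)] \<open>compact S\<close> \<open>C \<inter> S = {}\<close>]
    by metis
  obtain \<phi> c where \<phi>: "smooth \<phi>" "convex_on UNIV \<phi>" "mono \<phi>" "\<And>s t. s \<le> t \<Longrightarrow> \<phi> t - \<phi> s \<le> t - s"
    "\<And>s. s \<le> 0 \<Longrightarrow> \<phi> s = 0" "\<And>s. 1 \<le> s \<Longrightarrow> \<phi> s = s - c"
    using smooth_ramp by metis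
  have \<phi>_pos: "0 \<le> \<phi> s" for s
    using \<phi>(5)[of "min s 0"] monoD[OF \<phi>(3), of "min s 0" s] by simp
  have "continuous_on K g"
  proof -
    have "continuous_on (?N r) (hderiv g [])"
      using g(1) unfolding Cm_on_def by (metis i0_lb list.size(3) zero_enat_def)
    then show ?thesis
      using \<open>0 < r\<close> by (auto intro: continuous_on_subset simp: K_def)
  qed
  then obtain M where M: "\<And>x. x \<in> K \<Longrightarrow> \<bar>g x\<bar> \<le> M"
    using compact_continuous_image[OF _ \<open>compact K\<close>] compact_imp_bounded
    by (metis bounded_iff imageI real_norm_def)
  have "C \<subseteq> K" using \<open>0 < r\<close> by (auto simp: K_def)
  have "M \<ge> 0" using M C(3) \<open>C \<subseteq> K\<close> by (smt (verit) abs_ge_zero ex_in_conv subsetD)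
  \<comment> \<open>Since $|g| \<le> M$ on \<open>K\<close>, the value $-(M+1)$ on \<open>C\<close> is at most $g - 1$, and the value on \<open>S\<close>
    is at least $(2M+1) - (M+1) = M$.\<close>
  define H where "H = (\<lambda>x. (2 * M + 1) * \<psi> x - (M + 1))"
  have "Cm_on m UNIV H"
    unfolding H_def by (intro Cm_on_diff Cm_on_mult Cm_on_const \<psi>(1)) auto
  moreover have "convex_on UNIV (\<lambda>x. (2 * M + 1) * \<psi> x + - (M + 1))"
    using \<open>M \<ge> 0\<close> by (intro convex_on_add convex_on_cmul \<psi>(2)) (auto simp: convex_on_const)
  moreover have "H = (\<lambda>x. (2 * M + 1) * \<psi> x + - (M + 1))"
    by (simp add: H_def fun_eq_iff)
  ultimately have H: "Cm_on m UNIV H" "convex_on UNIV H"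
    by (simp_all only:)
  define G where "G = (\<lambda>x. H x + \<phi> (g x - H x))"
  define F where "F = (\<lambda>x. if infdist x C < r / 2 then G x else H x)"
  have GH: "G x = H x" if "x \<in> S" for x
  proof -
    have "g x \<le> M"
      using M[of x] that by (auto simp: S_def)
    also have "M \<le> H x"
    proof -
      have "(2 * M + 1) * 1 \<le> (2 * M + 1) * \<psi> x"
        using \<psi>(5)[OF that] \<open>M \<ge> 0\<close> by (intro mult_left_mono) auto
      moreover have "M \<le> p - (M + 1)" if "(2 * M + 1) * 1 \<le> p" for p
        using that by simp
      ultimately show ?thesis
        unfolding H_def by blast
    qed
    finally show ?thesis by (simp add: G_def \<phi>(5))
  qed
  have FG: "F x = G x" if "infdist x C < r / 2" for x
    using that by (simp add: F_def)
  have FH: "F x = H x" if "r / 4 < infdist x C" for x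
    using that GH[of x] by (auto simp: F_def S_def K_def)
  have HF: "H x \<le> F x" for x
    using \<phi>_pos by (simp add: F_def G_def)
  have FC: "F x = g x - c" if "x \<in> C" for x
  proof -
    have "1 \<le> g x - H x"
      using M[of x] \<open>C \<subseteq> K\<close> that \<psi>(4) by (auto simp: H_def)
    then show ?thesis
      using that \<open>0 < r\<close> \<phi>(6) by (simp add: FG G_def)
  qed
  have U: "UNIV = ?N (r / 2) \<union> {x. r / 4 < infdist x C}"
    using \<open>0 < r\<close> by auto
  have o': "open {x. r / 4 < infdist x C}"
    by (intro open_Collect_less continuous_intros)
  have sub: "?N (r / 2) \<subseteq> ?N r" using \<open>0 < r\<close> by auto
  have "Cm_on m (?N (r / 2)) G"
    unfolding G_def
    using Cm_on_subset[OF H(1) subset_UNIV] Cm_on_subset[OF g(1) sub]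
    by (intro Cm_on_add Cm_on_smooth_compose[OF _ \<phi>(1)] Cm_on_diff oN)
  then have "Cm_on m (?N (r / 2)) F"
    by (rule Cm_on_cong[OF oN, rotated]) (simp add: FG)
  moreover have "Cm_on m {x. r / 4 < infdist x C} F"
    by (rule Cm_on_cong[OF o' _ Cm_on_subset[OF H(1) subset_UNIV]]) (simp add: FH)
  ultimately have Cm: "Cm_on m UNIV F"
    using U oN o' Cm_on_Un by metis
  have "convex_on (?N (r / 2)) G"
    unfolding G_def
    by (intro convex_on_smooth_max[OF _ _ \<phi>(2,3,4)] convex_on_subset[OF g(2) sub]
        convex_on_subset[OF H(2)] convex_infdist_less compact_imp_closed C) auto
  have cont: "continuous_on UNIV F"
    using Cm unfolding Cm_on_def by (metis hderiv.simps(1) i0_lb list.size(3) zero_enat_def)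
  have "convex_on UNIV F"
  proof (rule locally_midpoint_convex_imp_convex[OF cont])
    fix z
    show "\<exists>\<delta>>0. \<forall>h. norm h < \<delta> \<longrightarrow> F z \<le> (F (z - h) + F (z + h)) / 2"
    proof (cases "infdist z C < r / 2")
      case True
      then obtain \<delta> where "\<delta> > 0" and \<delta>: "ball z \<delta> \<subseteq> ?N (r / 2)"
        using oN[of "r / 2"] by (auto elim: openE)
      have "F z \<le> (F (z - h) + F (z + h)) / 2" if "norm h < \<delta>" for h
      proof -
        have *: "z - h \<in> ?N (r / 2)" "z + h \<in> ?N (r / 2)"
          using that subsetD[OF \<delta>, of "z - h"] subsetD[OF \<delta>, of "z + h"] by (simp_all add: dist_norm)
        have "(1 - 1 / 2) *\<^sub>R (z - h) + (1 / 2) *\<^sub>R (z + h) = z"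
          by (simp add: algebra_simps flip: scaleR_add_left)
        then show ?thesis
          using convex_onD[OF \<open>convex_on (?N (r / 2)) G\<close>, of "1/2", OF _ _ *] FG * True by simp
      qed
      then show ?thesis using \<open>\<delta> > 0\<close> by blast
    next
      case False
      have "F z \<le> (F (z - h) + F (z + h)) / 2" for h
      proof -
        have "(1 - 1 / 2) *\<^sub>R (z - h) + (1 / 2) *\<^sub>R (z + h) = z"
          by (simp add: algebra_simps flip: scaleR_add_left)
        then show ?thesis
          using convex_onD[OF H(2), of "1/2" "z - h" "z + h"] False HF[of "z - h"] HF[of "z + h"]
          by (simp add: F_def)
      qed
      then show ?thesis using zero_less_one by blast
    qed
  qed
  show ?thesis
  proof (rule that)
    show "convex_on UNIV (\<lambda>x. F x + c)"
      using \<open>convex_on UNIV F\<close> by (intro convex_on_add) (simp_all add: convex_on_const)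
    show "Cm_on m UNIV (\<lambda>x. F x + c)"
      by (intro Cm_on_add Cm_on_const Cm) auto
    show "F x + c = g x" if "x \<in> C" for x
      using FC[OF that] by simp
  qed
qed

theorem corollary1p7:
  fixes C U :: "(real ^ 'n) set" and f g :: "real ^ 'n \<Rightarrow> real" and m :: enat and k :: nat
  assumes "2 \<le> m"
    and "convex C" and "compact C"
    and "convex_on C f"
    and "open U" and "C \<subseteq> U" and "Cm_on m U g" and "\<And>x. x \<in> C \<Longrightarrow> g x = f x"
    and "2 \<le> k" and "enat k \<le> m"
    and "CW_strict k C g"
  shows "\<exists>F :: real ^ 'n \<Rightarrow> real. convex_on UNIV F \<and> Cm_on m UNIV F \<and> (\<forall>x\<in>C. F x = f x)"
proof (cases "C = {}")
  case True
  then show ?thesis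
    by (intro exI[of _ "\<lambda>_. 0"]) (simp add: convex_on_const Cm_on_const)
next
  case False
  obtain \<rho> where \<rho>: "0 < \<rho>" "(\<Union>x\<in>C. cball x \<rho>) \<subseteq> U"
    using compact_subset_open_imp_cball_epsilon_subset[OF \<open>compact C\<close> \<open>open U\<close> \<open>C \<subseteq> U\<close>] .
  have \<rho>': "{x. infdist x C \<le> \<rho>} \<subseteq> U"
  proof
    fix x assume "x \<in> {x. infdist x C \<le> \<rho>}"
    moreover obtain y where "y \<in> C" "infdist x C = dist x y"
      using infdist_attains_inf[OF compact_imp_closed[OF \<open>compact C\<close>] False] by blast
    ultimately have "x \<in> cball y \<rho>"
      by (simp add: dist_commute)
    with \<open>y \<in> C\<close> \<rho>(2) show "x \<in> U"
      by blast
  qed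
  have "compact {x. infdist x C \<le> \<rho>}"
    by (intro compact_infdist_le False \<open>compact C\<close> \<rho>)
  obtain r where r: "0 < r" "r \<le> \<rho>" "\<And>x v. infdist x C < r \<Longrightarrow> 0 \<le> hderiv g [v, v] x"
    using CW_strict_imp_second_derivative_nonneg[OF compact_imp_closed[OF \<open>compact C\<close>] False \<open>open U\<close> \<rho>'
        \<open>compact {x. infdist x C \<le> \<rho>}\<close> \<rho>(1) \<open>Cm_on m U g\<close> \<open>2 \<le> k\<close> \<open>enat k \<le> m\<close> \<open>CW_strict k C g\<close>]
    by metis
  have sub: "{x. infdist x C < r} \<subseteq> U"
    using \<rho>' r(2) by auto
  have "convex_on {x. infdist x C < r} g"
    by (rule second_derivative_nonneg_imp_convex_on[OF \<open>Cm_on m U g\<close> \<open>2 \<le> m\<close> _ sub])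
      (use r convex_infdist_less[OF \<open>convex C\<close> compact_imp_closed[OF \<open>compact C\<close>] False] in \<open>auto simp del: hderiv.simps\<close>)
  then obtain F where "convex_on UNIV F" "Cm_on m UNIV F" "\<And>x. x \<in> C \<Longrightarrow> F x = g x"
    using convex_extension_from_neighbourhood[OF \<open>convex C\<close> \<open>compact C\<close> False r(1) Cm_on_subset[OF \<open>Cm_on m U g\<close> sub]]
    by metis
  then show ?thesis
    using \<open>\<And>x. x \<in> C \<Longrightarrow> g x = f x\<close> by metis
qed

end
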